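(* Temporal $\Delta$ Clique on temporal unit interval graphs $\mathcal{G}=(V,\mathcal{E},\tau)$ can be approximated within a factor of $(2\Delta)^{\tau-\Delta+1}$.
   Context: A temporal graph $\mathcal{G}=(V,\mathcal{E},\tau)$ consists of a finite vertex set $V$, a lifetime $\tau\in\mathbb{N}$ and a set of time-edges $\mathcal{E}\subseteq\binom{V}{2}\times\{1,\dots,\tau\}$. Its $t$-th layer is the static graph $G_t=(V,E_t)$ with $E_t=\{\{u,v\}:(\{u,v\},t)\in\mathcal{E}\}$. A temporal unit interval graph is a temporal graph each of whose layers is a unit interval graph (intersection graph of intervals of equal length on the real line). Let $1\le\Delta\le\tau$ be an integer. The $\Delta$-association graph of $\mathcal{G}$ is the static graph $\bigl(V,\bigcap_{i=1}^{\tau-\Delta+1}\bigcup_{j=i}^{i+\Delta-1}E_j\bigr)$. The optimization version of Temporal $\Delta$ Clique asks, given $\mathcal{G}$, for a maximum-size set $V'\subseteq V$ that is a clique in the $\Delta$-association graph of $\mathcal{G}$. "Approximated within a factor of $\alpha$" means that there is a polynomial-time algorithm that always outputs a clique of the $\Delta$-association graph of size at least $\mathrm{opt}/\alpha$, where $\mathrm{opt}$ is the maximum size of such a clique. *)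

theory Defs
  imports Complex_Main "HOL-Computational_Algebra.Polynomial"
begin

section \<open>Temporal graphs\<close>

record 'a temporal_graph =
  verts :: "'a set"
  tedges :: "('a set \<times> nat) set"
  lifetime :: nat

definition temporal_graph :: "'a temporal_graph \<Rightarrow> bool" where
  "temporal_graph G \<longleftrightarrow> finite (verts G) \<and>
     tedges G \<subseteq> {e. e \<subseteq> verts G \<and> card e = 2} \<times> {1..lifetime G}"

definition layer :: "'a temporal_graph \<Rightarrow> nat \<Rightarrow> 'a set set" where
  "layer G t = {e. (e, t) \<in> tedges G}"

text \<open>Static graphs are given by a vertex set and a set of two-element edges.\<close>

definition unit_interval_graph :: "'a set \<Rightarrow> 'a set set \<Rightarrow> bool" where
  "unit_interval_graph V E \<longleftrightarrow>
     (\<exists>(l::real) (I :: 'a \<Rightarrow> real set). l > 0 \<and> (\<forall>v\<in>V. \<exists>a. I v = {a..a + l}) \<and>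
        E = {{u, v} | u v. u \<in> V \<and> v \<in> V \<and> u \<noteq> v \<and> I u \<inter> I v \<noteq> {}})"

definition temporal_unit_interval_graph :: "'a temporal_graph \<Rightarrow> bool" where
  "temporal_unit_interval_graph G \<longleftrightarrow>
     temporal_graph G \<and> (\<forall>t\<in>{1..lifetime G}. unit_interval_graph (verts G) (layer G t))"

definition association_edges :: "nat \<Rightarrow> 'a temporal_graph \<Rightarrow> 'a set set" where
  "association_edges \<Delta> G =
     (\<Inter>i\<in>{1..lifetime G - \<Delta> + 1}. \<Union>j\<in>{i..i + \<Delta> - 1}. layer G j)"

definition clique :: "'a set \<Rightarrow> 'a set set \<Rightarrow> 'a set \<Rightarrow> bool" where
  "clique V E C \<longleftrightarrow> C \<subseteq> V \<and> (\<forall>u\<in>C. \<forall>v\<in>C. u \<noteq> v \<longrightarrow> {u, v} \<in> E)"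

definition temporal_clique :: "nat \<Rightarrow> 'a temporal_graph \<Rightarrow> 'a set \<Rightarrow> bool" where
  "temporal_clique \<Delta> G C \<longleftrightarrow> clique (verts G) (association_edges \<Delta> G) C"

definition opt_temporal_clique :: "nat \<Rightarrow> 'a temporal_graph \<Rightarrow> nat" where
  "opt_temporal_clique \<Delta> G = Max {card C | C. temporal_clique \<Delta> G C}"


section \<open>Random access machines\<close>

text \<open>
  Algorithms are programs of a deterministic random access machine, written in structured form.
  The memory consists of named arrays of natural numbers with unbounded index range; a program
  mentions finitely many of them, and scalar variables are arrays used at index 0 only.

  Every assignment and every test costs one step.  The only arithmetic operations are addition
  and truncated subtraction, so the bit lengths of the numbers grow by at most a constant
  (depending on the program) per step.  Hence polynomial time in this model coincides with
  polynomial time on Turing machines; this would fail if multiplication had unit cost.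
\<close>

type_synonym vname = string
type_synonym state = "vname \<Rightarrow> nat \<Rightarrow> nat"

datatype aexp = Const nat | Elem vname aexp | Plus aexp aexp | Minus aexp aexp

datatype bexp = Less aexp aexp | Not bexp | And bexp bexp

datatype com =
    Skip
  | Assign vname aexp aexp
  | Seq com com
  | If bexp com com
  | While bexp com

fun aval :: "aexp \<Rightarrow> state \<Rightarrow> nat" where
  "aval (Const n) s = n"
| "aval (Elem x i) s = s x (aval i s)"
| "aval (Plus a b) s = aval a s + aval b s"
| "aval (Minus a b) s = aval a s - aval b s"

fun bval :: "bexp \<Rightarrow> state \<Rightarrow> bool" where
  "bval (Less a b) s \<longleftrightarrow> aval a s < aval b s"
| "bval (Not b) s \<longleftrightarrow> \<not> bval b s"
| "bval (And b c) s \<longleftrightarrow> bval b s \<and> bval c s"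

text \<open>\<open>exec c s t s'\<close>: started in \<open>s\<close>, the program \<open>c\<close> halts in \<open>s'\<close> after \<open>t\<close> steps.\<close>

inductive exec :: "com \<Rightarrow> state \<Rightarrow> nat \<Rightarrow> state \<Rightarrow> bool" where
  Skip: "exec Skip s 1 s"
| Assign: "exec (Assign x i a) s 1 (s(x := (s x)(aval i s := aval a s)))"
| Seq: "exec c1 s1 t1 s2 \<Longrightarrow> exec c2 s2 t2 s3 \<Longrightarrow> exec (Seq c1 c2) s1 (t1 + t2) s3"
| IfTrue: "bval b s \<Longrightarrow> exec c1 s t s' \<Longrightarrow> exec (If b c1 c2) s (1 + t) s'"
| IfFalse: "\<not> bval b s \<Longrightarrow> exec c2 s t s' \<Longrightarrow> exec (If b c1 c2) s (1 + t) s'"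
| WhileFalse: "\<not> bval b s \<Longrightarrow> exec (While b c) s 1 s"
| WhileTrue: "bval b s1 \<Longrightarrow> exec c s1 t1 s2 \<Longrightarrow> exec (While b c) s2 t2 s3 \<Longrightarrow>
    exec (While b c) s1 (1 + t1 + t2) s3"

lemma exec_deterministic:
  "exec c s t1 s1 \<Longrightarrow> exec c s t2 s2 \<Longrightarrow> t1 = t2 \<and> s1 = s2"
proof (induction c s t1 s1 arbitrary: t2 s2 rule: exec.induct)
  case (Skip s)
  from Skip.prems show ?case by cases simp
next
  case (Assign x i a s)
  from Assign.prems show ?case by cases simp
next
  case (Seq c1 r1 t1 r2 c2 u2 r3)
  from Seq.prems show ?case by cases (use Seq.IH in blast)
next
  case (IfTrue b s c1 t s' c2)
  from IfTrue.prems show ?case by cases (use IfTrue.IH IfTrue.hyps in blast)+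
next
  case (IfFalse b s c2 t s' c1)
  from IfFalse.prems show ?case by cases (use IfFalse.IH IfFalse.hyps in blast)+
next
  case (WhileFalse b s c)
  from WhileFalse.prems show ?case by cases (use WhileFalse.hyps in simp_all)
next
  case (WhileTrue b r1 c t1 r2 u2 r3)
  from WhileTrue.prems show ?case by cases (use WhileTrue.IH WhileTrue.hyps in blast)+
qed

definition input_state :: "bool list \<Rightarrow> state" where
  "input_state xs = (\<lambda>_ _. 0)
     (''in'' := (\<lambda>i. if i < length xs \<and> xs ! i then 1 else 0),
      ''inlen'' := (\<lambda>i. if i = 0 then length xs else 0))"

definition output_of :: "state \<Rightarrow> bool list" where
  "output_of s = map (\<lambda>i. s ''out'' i \<noteq> 0) [0..<s ''outlen'' 0]"

definition runs :: "com \<Rightarrow> bool list \<Rightarrow> nat \<Rightarrow> bool list \<Rightarrow> bool" where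
  "runs p xs t ys \<longleftrightarrow> (\<exists>s. exec p (input_state xs) t s \<and> output_of s = ys)"


section \<open>Approximation of the maximum temporal clique\<close>

text \<open>
  An instance is presented relative to an arbitrary enumeration \<open>vs\<close> of the vertices:
  the number of vertices, the lifetime and \<open>\<Delta>\<close> in unary, followed by the adjacency matrices
  of the layers.  The length of this bit string is polynomially related to
  \<open>|V| + |\<E>| + \<tau>\<close>.  No interval representation is part of the input.
\<close>

definition unary :: "nat \<Rightarrow> bool list" where
  "unary n = replicate n True @ [False]"

definition encode_instance :: "'a list \<Rightarrow> 'a temporal_graph \<Rightarrow> nat \<Rightarrow> bool list" where
  "encode_instance vs G \<Delta> =
     unary (length vs) @ unary (lifetime G) @ unary \<Delta> @
     [{u, v} \<in> layer G t. t \<leftarrow> [1..<lifetime G + 1], u \<leftarrow> vs, v \<leftarrow> vs]"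

definition encode_vertex_set :: "'a list \<Rightarrow> 'a set \<Rightarrow> bool list" where
  "encode_vertex_set vs C = map (\<lambda>v. v \<in> C) vs"

text \<open>
  \<open>\<G>\<close> is the class of admissible temporal graphs and \<open>\<alpha>\<close> the approximation factor, which may
  depend on the instance.  A single program \<open>p\<close> with a single polynomial time bound \<open>q\<close> serves
  all instances; in particular \<open>\<Delta>\<close> and the lifetime are not treated as constants.
  Vertices are natural numbers because an HOL type cannot be quantified inside the scope
  of \<open>p\<close>; every finite temporal graph is isomorphic to one of this form.
\<close>

definition temporal_clique_approximable_within ::
    "(nat temporal_graph \<Rightarrow> bool) \<Rightarrow> (nat temporal_graph \<Rightarrow> nat \<Rightarrow> real) \<Rightarrow> bool" where
  "temporal_clique_approximable_within \<G> \<alpha> \<longleftrightarrow>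
     (\<exists>(p :: com) (q :: nat poly). \<forall>G \<Delta> vs.
        \<G> G \<and> 1 \<le> \<Delta> \<and> \<Delta> \<le> lifetime G \<and> distinct vs \<and> set vs = verts G \<longrightarrow>
        (\<exists>C t. runs p (encode_instance vs G \<Delta>) t (encode_vertex_set vs C) \<and>
           t \<le> poly q (length (encode_instance vs G \<Delta>)) \<and>
           temporal_clique \<Delta> G C \<and>
           real (card C) \<ge> real (opt_temporal_clique \<Delta> G) / \<alpha> G \<Delta>))"

end

theory Submission
  imports Defs "HOL-Library.FuncSet"
begin

text \<open>
  Fix a vertex \<open>v\<close> and a layer \<open>t\<close>.  If \<open>w\<close> is the neighbour of \<open>v\<close> whose interval lies leftmost, then
  \<open>N[v] \<inter> N[w]\<close> and \<open>N[v] - N[w]\<close> are both cliques of the layer; a vertex \<open>w\<close> with this property (a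
  pivot) can be found without an interval representation.  Give every \<open>u\<close> in the closed neighbourhood
  of \<open>v\<close> in the association graph a signature: for each of the \<open>k = \<tau> - \<Delta> + 1\<close> windows, the first layer
  of the window in which \<open>u\<close> is adjacent to \<open>v\<close>, and whether \<open>u\<close> is adjacent there to the pivot.
  Vertices with equal signatures form a clique of the association graph, and there are at most
  \<open>(2\<Delta>)\<^sup>k\<close> signatures, so if \<open>v\<close> lies in a maximum clique, some class around \<open>v\<close> has size at least
  \<open>opt / (2\<Delta>)\<^sup>k\<close>.  Only classes of actual vertices have to be compared, so the running time is
  polynomial even though the number of signatures is not.
\<close>

section \<open>Functions computable in polynomial time\<close>

text \<open>Weaker than equality with \<open>input_state xs\<close>: only the input arrays are
  constrained, so writes to \<open>''r''\<close>, \<open>''out''\<close> and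
  \<open>''outlen''\<close> preserve it.\<close>

definition has_input :: "bool list \<Rightarrow> state \<Rightarrow> bool" where
  "has_input xs s \<longleftrightarrow> s ''in'' = (\<lambda>i. of_bool (i < length xs \<and> xs ! i)) \<and> s ''inlen'' 0 = length xs"

text \<open>Protecting the registers below \<open>d\<close> keeps variables and intermediate results
  alive while a subprogram with a larger target runs; protecting the other arrays keeps the input
  readable.\<close>

definition computes :: "com \<Rightarrow> state \<Rightarrow> nat \<Rightarrow> nat \<Rightarrow> nat \<Rightarrow> bool" where
  "computes c s T d y \<longleftrightarrow>
     (\<exists>t s'. exec c s t s' \<and> t \<le> T \<and> s' ''r'' d = y \<and>
        (\<forall>i<d. s' ''r'' i = s ''r'' i) \<and> (\<forall>a. a \<noteq> ''r'' \<longrightarrow> s' a = s a))"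

lemma computesI:
  assumes "exec c s t s'" "t \<le> T" "s' ''r'' d = y"
    "\<And>i. i < d \<Longrightarrow> s' ''r'' i = s ''r'' i" "\<And>a. a \<noteq> ''r'' \<Longrightarrow> s' a = s a"
  shows "computes c s T d y"
  using assms unfolding computes_def by blast

text \<open>
  Array \<open>''r''\<close> serves as the register file: variable \<open>x\<close> of the environment lives in register \<open>r x\<close>,
  the result goes to register \<open>d\<close>, and the registers from \<open>d\<close> on are scratch.  The bound \<open>q\<close> limits
  the value as well as the time, because the value may become the bound of a loop.
\<close>

definition implements ::
    "com \<Rightarrow> nat poly \<Rightarrow> (nat \<Rightarrow> nat) \<Rightarrow> nat \<Rightarrow> (bool list \<Rightarrow> (nat \<Rightarrow> nat) \<Rightarrow> nat) \<Rightarrow> bool" where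
  "implements c q r d f \<longleftrightarrow> (\<forall>xs s N.
     has_input xs s \<longrightarrow> length xs \<le> N \<longrightarrow> (\<forall>x. s ''r'' (r x) \<le> N) \<longrightarrow>
     f xs (\<lambda>x. s ''r'' (r x)) \<le> poly q N \<and>
     computes c s (poly q N) d (f xs (\<lambda>x. s ''r'' (r x))))"

text \<open>
  Environments are de Bruijn style: binding a value shifts the variables by one and makes the new
  value variable 0.
\<close>

definition feasible :: "(bool list \<Rightarrow> (nat \<Rightarrow> nat) \<Rightarrow> nat) \<Rightarrow> bool" where
  "feasible f \<longleftrightarrow> (\<forall>r d. (\<forall>x. r x < d) \<longrightarrow> (\<exists>c q. implements c q r d f))"

lemma implementsI:
  assumes "\<And>xs s N \<rho>. has_input xs s \<Longrightarrow> length xs \<le> N \<Longrightarrow> \<rho> = (\<lambda>x. s ''r'' (r x)) \<Longrightarrow> (\<And>x. \<rho> x \<le> N) \<Longrightarrow>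
    f xs \<rho> \<le> poly q N \<and> computes c s (poly q N) d (f xs \<rho>)"
  shows "implements c q r d f"
  using assms unfolding implements_def by simp

lemma implementsD:
  assumes "implements c q r d f" "has_input xs s" "length xs \<le> N"
    "\<rho> = (\<lambda>x. s ''r'' (r x))" "\<And>x. \<rho> x \<le> N"
  shows "f xs \<rho> \<le> poly q N" "computes c s (poly q N) d (f xs \<rho>)"
  using assms unfolding implements_def by simp_all

lemma feasible_aexp:
  assumes "\<And>r. \<exists>a q. \<forall>xs s N. has_input xs s \<longrightarrow> length xs \<le> N \<longrightarrow> (\<forall>x. s ''r'' (r x) \<le> N) \<longrightarrow>
     aval a s = f xs (\<lambda>x. s ''r'' (r x)) \<and> aval a s \<le> poly q N"
  shows "feasible f"
  unfolding feasible_def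
proof (intro allI impI)
  fix r :: "nat \<Rightarrow> nat" and d
  obtain a q where a: "\<forall>xs s N. has_input xs s \<longrightarrow> length xs \<le> N \<longrightarrow> (\<forall>x. s ''r'' (r x) \<le> N) \<longrightarrow>
     aval a s = f xs (\<lambda>x. s ''r'' (r x)) \<and> aval a s \<le> poly q N"
    using assms[of r] by blast
  \<comment> \<open>\<open>q\<close> bounds the value only; the added 1 pays for the
    assignment.\<close>
  have "implements (Assign ''r'' (Const d) a) (q + [:1:]) r d f"
  proof (rule implementsI)
    fix xs s N \<rho>
    assume "has_input xs s" "length xs \<le> N" "\<rho> = (\<lambda>x. s ''r'' (r x))" "\<And>x. \<rho> x \<le> N"
    with a[rule_format, of xs s N] have *: "aval a s = f xs \<rho>" "aval a s \<le> poly q N" by auto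
    then show "f xs \<rho> \<le> poly (q + [:1:]) N \<and>
      computes (Assign ''r'' (Const d) a) s (poly (q + [:1:]) N) d (f xs \<rho>)"
      by (intro conjI computesI[OF exec.Assign]) auto
  qed
  then show "\<exists>c q. implements c q r d f" by blast
qed

section \<open>Basic expressions and variable binding\<close>

lemma feasible_const: "feasible (\<lambda>xs \<rho>. k)"
  by (rule feasible_aexp) (intro exI[of _ "Const k"] exI[of _ "[:k:]"], simp)

lemma feasible_var: "feasible (\<lambda>xs \<rho>. \<rho> k)"
proof (rule feasible_aexp)
  fix r :: "nat \<Rightarrow> nat"
  show "\<exists>a q. \<forall>xs s N. has_input xs s \<longrightarrow> length xs \<le> N \<longrightarrow> (\<forall>x. s ''r'' (r x) \<le> N) \<longrightarrow>
     aval a s = s ''r'' (r k) \<and> aval a s \<le> poly q N"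
    by (intro exI[of _ "Elem ''r'' (Const (r k))"] exI[of _ "[:0, 1:]"]) simp
qed

lemma feasible_length: "feasible (\<lambda>xs \<rho>. length xs)"
  by (rule feasible_aexp)
    (intro exI[of _ "Elem ''inlen'' (Const 0)"] exI[of _ "[:0, 1:]"], simp add: has_input_def)

lemma feasible_plus_var: "feasible (\<lambda>xs \<rho>. \<rho> i + \<rho> j)"
proof (rule feasible_aexp)
  fix r :: "nat \<Rightarrow> nat"
  show "\<exists>a q. \<forall>xs s N. has_input xs s \<longrightarrow> length xs \<le> N \<longrightarrow> (\<forall>x. s ''r'' (r x) \<le> N) \<longrightarrow>
     aval a s = s ''r'' (r i) + s ''r'' (r j) \<and> aval a s \<le> poly q N"
    by (intro exI[of _ "Plus (Elem ''r'' (Const (r i))) (Elem ''r'' (Const (r j)))"] exI[of _ "[:0, 2:]"])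
      (simp add: add_mono mult_2_right)
qed

lemma feasible_minus_var: "feasible (\<lambda>xs \<rho>. \<rho> i - \<rho> j)"
proof (rule feasible_aexp)
  fix r :: "nat \<Rightarrow> nat"
  show "\<exists>a q. \<forall>xs s N. has_input xs s \<longrightarrow> length xs \<le> N \<longrightarrow> (\<forall>x. s ''r'' (r x) \<le> N) \<longrightarrow>
     aval a s = s ''r'' (r i) - s ''r'' (r j) \<and> aval a s \<le> poly q N"
    by (intro exI[of _ "Minus (Elem ''r'' (Const (r i))) (Elem ''r'' (Const (r j)))"] exI[of _ "[:0, 1:]"])
      (auto intro: le_trans[OF diff_le_self])
qed

text \<open>The array \<open>''in''\<close> is 0 beyond the input, so a single read already includes
  the range check.\<close>

lemma feasible_bit_var: "feasible (\<lambda>xs \<rho>. of_bool (\<rho> i < length xs \<and> xs ! \<rho> i))"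
proof (rule feasible_aexp)
  fix r :: "nat \<Rightarrow> nat"
  show "\<exists>a q. \<forall>xs s N. has_input xs s \<longrightarrow> length xs \<le> N \<longrightarrow> (\<forall>x. s ''r'' (r x) \<le> N) \<longrightarrow>
     aval a s = of_bool (s ''r'' (r i) < length xs \<and> xs ! s ''r'' (r i)) \<and> aval a s \<le> poly q N"
    by (intro exI[of _ "Elem ''in'' (Elem ''r'' (Const (r i)))"] exI[of _ "[:1:]"])
      (simp add: has_input_def)
qed

text \<open>No code is added: the program for the register map composed with \<open>\<sigma>\<close>
  serves.\<close>

lemma feasible_rename:
  assumes "feasible f"
  shows "feasible (\<lambda>xs \<rho>. f xs (\<lambda>x. \<rho> (\<sigma> x)))"
  unfolding feasible_def
proof (intro allI impI)
  fix r :: "nat \<Rightarrow> nat" and d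
  assume "\<forall>x. r x < d"
  with assms obtain c q where "implements c q (\<lambda>x. r (\<sigma> x)) d f"
    unfolding feasible_def by meson
  then have "implements c q r d (\<lambda>xs \<rho>. f xs (\<lambda>x. \<rho> (\<sigma> x)))"
    by (simp add: implements_def)
  then show "\<exists>c q. implements c q r d (\<lambda>xs \<rho>. f xs (\<lambda>x. \<rho> (\<sigma> x)))" by blast
qed

text \<open>The value of \<open>f\<close> is stored in register \<open>d\<close>, which becomes
  variable 0 of \<open>g\<close>. Then \<open>g\<close> works with target \<open>Suc d\<close>,
  above every register in use, and its result is moved down to \<open>d\<close>.\<close>

lemma feasible_let:
  assumes f: "feasible f" and g: "feasible (\<lambda>xs \<rho>. g xs (\<lambda>x. \<rho> (Suc x)) (\<rho> 0))"
  shows "feasible (\<lambda>xs \<rho>. g xs \<rho> (f xs \<rho>))"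
  unfolding feasible_def
proof (intro allI impI)
  fix r :: "nat \<Rightarrow> nat" and d
  assume r: "\<forall>x. r x < d"
  with f obtain cf qf where cf: "implements cf qf r d f"
    unfolding feasible_def by meson
  define r' where "r' = case_nat d r"
  have r': "\<forall>x. r' x < Suc d" using r by (auto simp: r'_def less_SucI split: nat.split)
  with g obtain cg qg where cg: "implements cg qg r' (Suc d) (\<lambda>xs \<rho>. g xs (\<lambda>x. \<rho> (Suc x)) (\<rho> 0))"
    unfolding feasible_def by meson
  let ?mv = "Assign ''r'' (Const d) (Elem ''r'' (Const (Suc d)))"
  let ?c = "Seq cf (Seq cg ?mv)"
  \<comment> \<open>The environment of \<open>g\<close> contains the value of \<open>f\<close>, so
    its entries are bounded by \<open>poly qf N + N\<close> instead of \<open>N\<close>; hence the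
    composition. The last summand pays for the move.\<close>
  let ?q = "qf + pcompose qg (qf + [:0, 1:]) + [:1:]"
  have "implements ?c ?q r d (\<lambda>xs \<rho>. g xs \<rho> (f xs \<rho>))"
  proof (rule implementsI)
    fix xs s N \<rho>
    assume i: "has_input xs s" and l: "length xs \<le> N" and \<rho>: "\<rho> = (\<lambda>x. s ''r'' (r x))"
      and n: "\<And>x. \<rho> x \<le> N"
    have fb: "f xs \<rho> \<le> poly qf N" and "computes cf s (poly qf N) d (f xs \<rho>)"
      using implementsD[OF cf i l \<rho> n] .
    then obtain t1 s1 where s1: "exec cf s t1 s1" "t1 \<le> poly qf N" "s1 ''r'' d = f xs \<rho>"
      "\<forall>i<d. s1 ''r'' i = s ''r'' i" "\<forall>a. a \<noteq> ''r'' \<longrightarrow> s1 a = s a"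
      unfolding computes_def by blast
    have \<rho>1: "s1 ''r'' (r x) = \<rho> x" for x using s1(4) r \<rho> by simp
    have i1: "has_input xs s1" using i s1(5) by (simp add: has_input_def)
    let ?M = "poly qf N + N"
    have n1: "s1 ''r'' (r' x) \<le> ?M" for x
    proof (cases x)
      case 0
      then show ?thesis using fb s1(3) by (simp add: r'_def)
    next
      case (Suc y)
      then show ?thesis using n[of y] \<rho>1[of y] by (simp add: r'_def)
    qed
    have gb: "g xs \<rho> (f xs \<rho>) \<le> poly qg ?M"
      and "computes cg s1 (poly qg ?M) (Suc d) (g xs \<rho> (f xs \<rho>))"
      using implementsD[OF cg i1 _ refl n1] l by (simp_all add: r'_def \<rho>1 s1(3))
    then obtain t2 s2 where s2: "exec cg s1 t2 s2" "t2 \<le> poly qg ?M" "s2 ''r'' (Suc d) = g xs \<rho> (f xs \<rho>)"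
      "\<forall>i<Suc d. s2 ''r'' i = s1 ''r'' i" "\<forall>a. a \<noteq> ''r'' \<longrightarrow> s2 a = s1 a"
      unfolding computes_def by blast
    have "exec ?c s (t1 + (t2 + 1)) (s2(''r'' := (s2 ''r'')(d := s2 ''r'' (Suc d))))"
      using exec.Assign[of "''r''" "Const d" "Elem ''r'' (Const (Suc d))" s2]
      by (intro exec.Seq[OF s1(1)] exec.Seq[OF s2(1)]) simp
    then have "computes ?c s (poly ?q N) d (g xs \<rho> (f xs \<rho>))"
      by (rule computesI) (use s1 s2 in \<open>simp_all add: poly_pcompose\<close>)
    then show "g xs \<rho> (f xs \<rho>) \<le> poly ?q N \<and> computes ?c s (poly ?q N) d (g xs \<rho> (f xs \<rho>))"
      using gb by (simp add: poly_pcompose)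
  qed
  then show "\<exists>c q. implements c q r d (\<lambda>xs \<rho>. g xs \<rho> (f xs \<rho>))" by blast
qed

section \<open>Bounded loops and output\<close>

lemma exec_While_count:
  assumes "\<And>k s. k < B \<Longrightarrow> I k s \<Longrightarrow> bval b s \<and> (\<exists>t s'. exec c s t s' \<and> t \<le> T \<and> I (Suc k) s')"
    and "\<And>s. I B s \<Longrightarrow> \<not> bval b s" and "I 0 s"
  shows "\<exists>t s'. exec (While b c) s t s' \<and> t \<le> B * (T + 1) + 1 \<and> I B s'"
proof -
  \<comment> \<open>Induction on the number \<open>m\<close> of iterations still to come. Each costs
    at most \<open>T\<close> plus one test; the final 1 is the failing test.\<close>
  have "\<exists>t s'. exec (While b c) s t s' \<and> t \<le> m * (T + 1) + 1 \<and> I B s'" if "I k s" "k + m = B" for k m s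
    using that
  proof (induction m arbitrary: k s)
    case 0
    then show ?case using assms(2) exec.WhileFalse by fastforce
  next
    case (Suc m)
    then obtain t1 s1 where 1: "bval b s" "exec c s t1 s1" "t1 \<le> T" "I (Suc k) s1"
      using assms(1)[of k s] by auto
    with Suc obtain t2 s2 where 2: "exec (While b c) s1 t2 s2" "t2 \<le> m * (T + 1) + 1" "I B s2"
      by (metis add_Suc_shift)
    show ?case
      using exec.WhileTrue[OF 1(1,2) 2(1)] 1(3) 2(2,3) by fastforce
  qed
  from this[OF assms(3), of B] show ?thesis by simp
qed

text \<open>The loop runs polynomially often because feasibility bounds the value of
  \<open>f\<close> and not only its running time. Products, quantifiers and bounded search are all
  reduced to such sums.\<close>

lemma feasible_sum:
  assumes f: "feasible f" and g: "feasible (\<lambda>xs \<rho>. g xs (\<lambda>x. \<rho> (Suc x)) (\<rho> 0))"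
  shows "feasible (\<lambda>xs \<rho>. \<Sum>i<f xs \<rho>. g xs \<rho> i)"
  unfolding feasible_def
proof (intro allI impI)
  fix r :: "nat \<Rightarrow> nat" and d
  assume r: "\<forall>x. r x < d"
  with f obtain cf qf where cf: "implements cf qf r d f"
    unfolding feasible_def by meson
  \<comment> \<open>Layout: \<open>d\<close> holds the bound, \<open>d + 1\<close> the index
    (variable 0 of \<open>g\<close>), \<open>d + 2\<close> the partial sum and \<open>d + 3\<close>
    the current summand.\<close>
  define r' where "r' = case_nat (d + 1) r"
  have r': "\<forall>x. r' x < d + 3" using r by (auto simp: r'_def split: nat.split intro: less_trans)
  with g obtain cg qg where cg: "implements cg qg r' (d + 3) (\<lambda>xs \<rho>. g xs (\<lambda>x. \<rho> (Suc x)) (\<rho> 0))"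
    unfolding feasible_def by meson
  define R where "R i = Elem ''r'' (Const i)" for i
  define set where "set i a = Assign ''r'' (Const i) a" for i a
  have [simp]: "aval (R i) s = s ''r'' i" for i s by (simp add: R_def)
  have set: "exec (set i a) s 1 (s(''r'' := (s ''r'')(i := aval a s)))" for i a s
    using exec.Assign[of "''r''" "Const i" a s] by (simp add: set_def)
  let ?body = "Seq cg (Seq (set (d + 2) (Plus (R (d + 2)) (R (d + 3))))
     (set (d + 1) (Plus (R (d + 1)) (Const 1))))"
  let ?b = "Less (R (d + 1)) (R d)"
  let ?c = "Seq cf (Seq (set (d + 1) (Const 0)) (Seq (set (d + 2) (Const 0))
     (Seq (While ?b ?body) (set d (R (d + 2))))))"
  let ?qg = "pcompose qg (qf + [:0, 1:])"
  \<comment> \<open>Each iteration pays for the summand, the test and two assignments. The 4 covers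
    two initialisations, the failing test and the final copy.\<close>
  let ?q = "qf + qf * (?qg + [:3:]) + [:4:]"
  have "implements ?c ?q r d (\<lambda>xs \<rho>. \<Sum>i<f xs \<rho>. g xs \<rho> i)"
  proof (rule implementsI)
    fix xs s N \<rho>
    assume i: "has_input xs s" and l: "length xs \<le> N" and \<rho>: "\<rho> = (\<lambda>x. s ''r'' (r x))"
      and n: "\<And>x. \<rho> x \<le> N"
    let ?B = "f xs \<rho>" and ?G = "\<lambda>k. \<Sum>i<k. g xs \<rho> i" and ?T = "poly ?qg N"
    have fb: "?B \<le> poly qf N" and "computes cf s (poly qf N) d ?B"
      using implementsD[OF cf i l \<rho> n] .
    then obtain t1 s1 where s1: "exec cf s t1 s1" "t1 \<le> poly qf N" "s1 ''r'' d = ?B"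
      "\<forall>i<d. s1 ''r'' i = s ''r'' i" "\<forall>a. a \<noteq> ''r'' \<longrightarrow> s1 a = s a"
      unfolding computes_def by blast
    let ?s2 = "s1(''r'' := (s1 ''r'')(d + 1 := 0))"
    let ?s3 = "?s2(''r'' := (?s2 ''r'')(d + 2 := 0))"
    define I where "I k s' \<longleftrightarrow> s' ''r'' d = ?B \<and> s' ''r'' (d + 1) = k \<and> s' ''r'' (d + 2) = ?G k \<and>
       (\<forall>i<d. s' ''r'' i = s ''r'' i) \<and> (\<forall>a. a \<noteq> ''r'' \<longrightarrow> s' a = s a)" for k s'
    have step: "g xs \<rho> k \<le> ?T \<and> computes cg s' ?T (d + 3) (g xs \<rho> k)"
      if k: "k < ?B" and I: "I k s'" for k s'
    proof -
      have \<rho>1: "s' ''r'' (r x) = \<rho> x" for x using I r \<rho> by (simp add: I_def)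
      have i1: "has_input xs s'" using i I by (simp add: has_input_def I_def)
      have n1: "s' ''r'' (r' x) \<le> poly qf N + N" for x
      proof (cases x)
        case 0
        then show ?thesis using fb k I by (simp add: r'_def I_def)
      next
        case (Suc y)
        then show ?thesis using n[of y] \<rho>1[of y] by (simp add: r'_def)
      qed
      show ?thesis
        using implementsD[OF cg i1 _ refl n1] l I by (simp add: r'_def \<rho>1 I_def poly_pcompose)
    qed
    have I0: "I 0 ?s3" using s1 by (auto simp: I_def)
    have body: "bval ?b s' \<and> (\<exists>t s''. exec ?body s' t s'' \<and> t \<le> ?T + 2 \<and> I (Suc k) s'')"
      if k: "k < ?B" and I: "I k s'" for k s'
    proof -
      from step[OF k I] obtain t2 s2 where s2: "exec cg s' t2 s2" "t2 \<le> ?T" "s2 ''r'' (d + 3) = g xs \<rho> k"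
        "\<forall>i<d+3. s2 ''r'' i = s' ''r'' i" "\<forall>a. a \<noteq> ''r'' \<longrightarrow> s2 a = s' a"
        unfolding computes_def by blast
      have "exec ?body s' (t2 + (1 + 1)) ((s2(''r'' := (s2 ''r'')(d + 2 := ?G (Suc k))))
          (''r'' := ((s2(''r'' := (s2 ''r'')(d + 2 := ?G (Suc k)))) ''r'')(d + 1 := Suc k)))"
        using set[of "d + 2" "Plus (R (d + 2)) (R (d + 3))" s2]
          set[of "d + 1" "Plus (R (d + 1)) (Const 1)" "s2(''r'' := (s2 ''r'')(d + 2 := ?G (Suc k)))"] s2 I
        by (intro exec.Seq[OF s2(1)] exec.Seq[where ?s2.0 = "s2(''r'' := (s2 ''r'')(d + 2 := ?G (Suc k)))"])
          (simp_all add: I_def)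
      moreover have "I (Suc k) ((s2(''r'' := (s2 ''r'')(d + 2 := ?G (Suc k))))
          (''r'' := ((s2(''r'' := (s2 ''r'')(d + 2 := ?G (Suc k)))) ''r'')(d + 1 := Suc k)))"
        using s2 I by (auto simp: I_def)
      moreover have "t2 + (1 + 1) \<le> ?T + 2" "bval ?b s'"
        using s2(2) k I by (simp_all add: I_def)
      ultimately show ?thesis by blast
    qed
    obtain t4 s4 where s4: "exec (While ?b ?body) ?s3 t4 s4" "t4 \<le> ?B * (?T + 2 + 1) + 1" "I ?B s4"
      using exec_While_count[of ?B I ?b ?body "?T + 2" ?s3, OF body _ I0] by (auto simp: I_def)
    have ex: "exec ?c s (t1 + (1 + (1 + (t4 + 1)))) (s4(''r'' := (s4 ''r'')(d := s4 ''r'' (d + 2))))"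
      using set[of "d + 1" "Const 0" s1] set[of "d + 2" "Const 0" ?s2] set[of d "R (d + 2)" s4]
      by (intro exec.Seq[OF s1(1)] exec.Seq[where ?s2.0 = ?s2] exec.Seq[where ?s2.0 = ?s3] exec.Seq[OF s4(1)])
        simp_all
    have "?T + 2 + 1 = ?T + 3" by simp
    then have "?B * (?T + 2 + 1) \<le> poly qf N * (?T + 3)" by (metis fb mult_le_mono1)
    then have "t1 + (1 + (1 + (t4 + 1))) \<le> poly ?q N" using s4(2) s1(2) by simp
    then have c: "computes ?c s (poly ?q N) d (?G ?B)"
      using s4(3) by (intro computesI[OF ex]) (auto simp: I_def)
    \<comment> \<open>The value bound of \<open>implements\<close> is available only through a
      state, so for each \<open>k\<close> a state satisfying the invariant is written down
      directly.\<close>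
    have "g xs \<rho> k \<le> ?T" if k: "k < ?B" for k
    proof -
      let ?s = "s(''r'' := (s ''r'')(d := ?B, d + 1 := k, d + 2 := ?G k))"
      have "I k ?s" by (auto simp: I_def)
      then show ?thesis using step[OF k] by blast
    qed
    then have "?G ?B \<le> ?B * ?T" using sum_bounded_above[of "{..<?B}" "g xs \<rho>" ?T] by simp
    also have "\<dots> \<le> poly qf N * (?T + 3)" using fb by (auto intro: mult_mono)
    also have "\<dots> \<le> poly ?q N" by simp
    finally show "?G ?B \<le> poly ?q N \<and> computes ?c s (poly ?q N) d (?G ?B)" using c by blast
  qed
  then show "\<exists>c q. implements c q r d (\<lambda>xs \<rho>. \<Sum>i<f xs \<rho>. g xs \<rho> i)" by blast
qed

text \<open>Register 0 counts the output positions, register 1 holds their number, and each bit is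
  computed in register 2 before it is copied to \<open>''out''\<close>.\<close>

lemma runs_feasible:
  assumes n: "feasible (\<lambda>xs \<rho>. n xs)" and h: "feasible (\<lambda>xs \<rho>. h xs (\<rho> 0))"
  shows "\<exists>p q. \<forall>xs. \<exists>t. runs p xs t (map (\<lambda>i. h xs i \<noteq> 0) [0..<n xs]) \<and> t \<le> poly q (length xs)"
proof -
  \<comment> \<open>Neither function depends on a variable other than 0, so all variables may share
    register 0, which is 0 at the start.\<close>
  obtain cn qn where cn: "implements cn qn (\<lambda>_. 0) 1 (\<lambda>xs \<rho>. n xs)"
    using n[unfolded feasible_def, rule_format, of "\<lambda>_. 0" 1] by auto
  obtain ch qh where ch: "implements ch qh (\<lambda>_. 0) 2 (\<lambda>xs \<rho>. h xs (\<rho> 0))"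
    using h[unfolded feasible_def, rule_format, of "\<lambda>_. 0" 2] by auto
  define R where "R i = Elem ''r'' (Const i)" for i
  have [simp]: "aval (R i) s = s ''r'' i" for i s by (simp add: R_def)
  let ?out = "Assign ''out'' (R 0) (R 2)"
  let ?inc = "Assign ''r'' (Const 0) (Plus (R 0) (Const 1))"
  let ?b = "Less (R 0) (R 1)" and ?body = "Seq ch (Seq ?out ?inc)"
  let ?len = "Assign ''outlen'' (Const 0) (R 1)"
  let ?p = "Seq cn (Seq (While ?b ?body) ?len)"
  let ?qh = "pcompose qh (qn + [:0, 1:])"
  let ?q = "qn + qn * (?qh + [:3:]) + [:2:]"
  have "\<exists>t. runs ?p xs t (map (\<lambda>i. h xs i \<noteq> 0) [0..<n xs]) \<and> t \<le> poly ?q (length xs)" for xs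
  proof -
    let ?s = "input_state xs" and ?N = "length xs" and ?T = "poly ?qh (length xs)"
    have i: "has_input xs ?s" by (auto simp: has_input_def input_state_def)
    have "?s ''r'' 0 = 0" by (simp add: input_state_def)
    then have nb: "n xs \<le> poly qn ?N" and "computes cn ?s (poly qn ?N) 1 (n xs)"
      using implementsD[OF cn i le_refl refl] by auto
    then obtain t1 s1 where s1: "exec cn ?s t1 s1" "t1 \<le> poly qn ?N" "s1 ''r'' 1 = n xs"
      "\<forall>i<1. s1 ''r'' i = ?s ''r'' i" "\<forall>a. a \<noteq> ''r'' \<longrightarrow> s1 a = ?s a"
      unfolding computes_def by blast
    define I where "I k s \<longleftrightarrow> has_input xs s \<and> s ''r'' 0 = k \<and> s ''r'' 1 = n xs \<and>
      (\<forall>i<k. s ''out'' i = h xs i)" for k s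
    have I0: "I 0 s1" using s1 i by (auto simp: I_def has_input_def input_state_def)
    have body: "bval ?b s \<and> (\<exists>t s'. exec ?body s t s' \<and> t \<le> ?T + 2 \<and> I (Suc k) s')"
      if k: "k < n xs" and I: "I k s" for k s
    proof -
      have si: "has_input xs s" and s0: "s ''r'' 0 \<le> poly qn ?N + ?N" using I k nb by (simp_all add: I_def)
      have "computes ch s ?T 2 (h xs k)"
        using implementsD(2)[OF ch si _ refl, of "poly qn ?N + ?N"] s0 I by (simp add: poly_pcompose I_def)
      then obtain t2 s2 where s2: "exec ch s t2 s2" "t2 \<le> ?T" "s2 ''r'' 2 = h xs k"
        "\<forall>i<2. s2 ''r'' i = s ''r'' i" "\<forall>a. a \<noteq> ''r'' \<longrightarrow> s2 a = s a"
        unfolding computes_def by blast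
      let ?s3 = "s2(''out'' := (s2 ''out'')(k := h xs k))"
      let ?s4 = "?s3(''r'' := (?s3 ''r'')(0 := Suc k))"
      have "exec ?body s (t2 + (1 + 1)) ?s4"
        using exec.Assign[of "''out''" "R 0" "R 2" s2]
          exec.Assign[of "''r''" "Const 0" "Plus (R 0) (Const 1)" ?s3] s2 I
        by (intro exec.Seq[OF s2(1)] exec.Seq[where ?s2.0 = ?s3]) (simp_all add: I_def)
      moreover have "I (Suc k) ?s4"
        using s2 I by (auto simp: I_def has_input_def less_Suc_eq)
      moreover have "t2 + (1 + 1) \<le> ?T + 2" "bval ?b s"
        using s2(2) k I by (simp_all add: I_def)
      ultimately show ?thesis by blast
    qed
    obtain t4 s4 where s4: "exec (While ?b ?body) s1 t4 s4" "t4 \<le> n xs * (?T + 2 + 1) + 1" "I (n xs) s4"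
      using exec_While_count[of "n xs" I ?b ?body "?T + 2" s1, OF body _ I0] by (auto simp: I_def)
    let ?s5 = "s4(''outlen'' := (s4 ''outlen'')(0 := n xs))"
    have "exec ?p ?s (t1 + (t4 + 1)) ?s5"
      using exec.Assign[of "''outlen''" "Const 0" "R 1" s4] s4(3)
      by (intro exec.Seq[OF s1(1)] exec.Seq[OF s4(1)]) (simp_all add: I_def)
    moreover have "output_of ?s5 = map (\<lambda>i. h xs i \<noteq> 0) [0..<n xs]"
      using s4(3) by (auto simp: output_of_def I_def)
    ultimately have "runs ?p xs (t1 + (t4 + 1)) (map (\<lambda>i. h xs i \<noteq> 0) [0..<n xs])"
      unfolding runs_def by blast
    moreover have "t1 + (t4 + 1) \<le> poly ?q ?N"
    proof -
      have "?T + 2 + 1 = ?T + 3" by simp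
      then have "n xs * (?T + 2 + 1) \<le> poly qn ?N * (?T + 3)" by (metis nb mult_le_mono1)
      then show ?thesis using s4(2) s1(2) by simp
    qed
    ultimately show ?thesis by blast
  qed
  then show ?thesis by blast
qed

section \<open>Composition, arithmetic, logic and bounded search\<close>

lemma feasible_comp1:
  assumes "feasible (\<lambda>xs \<rho>. h xs (\<rho> 0))" "feasible f"
  shows "feasible (\<lambda>xs \<rho>. h xs (f xs \<rho>))"
  using feasible_let[OF assms(2), of "\<lambda>xs \<rho>. h xs"] assms(1) by simp

text \<open>The arguments are let-bound one after the other. The one bound last becomes variable 0,
  so the variables of \<open>h\<close> have to be renamed in reverse order.\<close>

lemma feasible_comp2:
  assumes h: "feasible (\<lambda>xs \<rho>. h xs (\<rho> 0) (\<rho> 1))" and f: "feasible f" and g: "feasible g"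
  shows "feasible (\<lambda>xs \<rho>. h xs (f xs \<rho>) (g xs \<rho>))"
proof (rule feasible_let[OF f])
  show "feasible (\<lambda>xs \<rho>. h xs (\<rho> 0) (g xs (\<lambda>x. \<rho> (Suc x))))"
    by (rule feasible_let[OF feasible_rename[OF g], of "\<lambda>xs \<rho>. h xs (\<rho> 0)"])
      (use feasible_rename[OF h, of "case_nat 1 (\<lambda>_. 0)"] in simp)
qed

lemma feasible_comp3:
  assumes h: "feasible (\<lambda>xs \<rho>. h xs (\<rho> 0) (\<rho> 1) (\<rho> 2))"
    and f: "feasible f" and g: "feasible g" and e: "feasible e"
  shows "feasible (\<lambda>xs \<rho>. h xs (f xs \<rho>) (g xs \<rho>) (e xs \<rho>))"
proof (rule feasible_let[OF f],
    rule feasible_let[OF feasible_rename[OF g], of "\<lambda>xs \<rho> y. h xs (\<rho> 0) y (e xs (\<lambda>x. \<rho> (Suc x)))"])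
  have "feasible (\<lambda>xs \<rho>. h xs (\<rho> 2) (\<rho> 1) (\<rho> 0))"
    using feasible_rename[OF h, of "\<lambda>i. 2 - i"] by simp
  then show "feasible (\<lambda>xs \<rho>. h xs (\<rho> (Suc 0)) (\<rho> 0) (e xs (\<lambda>x. \<rho> (Suc (Suc x)))))"
    by (intro feasible_let[OF feasible_rename[OF e], of "\<lambda>xs \<rho>. h xs (\<rho> (Suc 0)) (\<rho> 0)"])
      (simp add: numeral_2_eq_2)
qed

lemmas feasible_plus = feasible_comp2[where h = "\<lambda>_. (+)", OF feasible_plus_var[of 0 1]]
lemmas feasible_minus = feasible_comp2[where h = "\<lambda>_. (-)", OF feasible_minus_var[of 0 1]]

lemma feasible_Suc: "feasible f \<Longrightarrow> feasible (\<lambda>xs \<rho>. Suc (f xs \<rho>))"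
  using feasible_plus[OF _ feasible_const[of 1]] by simp

text \<open>The machine cannot multiply; the product is a sum with constant summand.\<close>

lemma feasible_mult:
  assumes f: "feasible f" and g: "feasible g"
  shows "feasible (\<lambda>xs \<rho>. f xs \<rho> * g xs \<rho>)"
  using feasible_sum[OF f, of "\<lambda>xs \<rho> i. g xs \<rho>"] feasible_rename[OF g, of Suc] by simp

lemma feasible_not:
  assumes "feasible (\<lambda>xs \<rho>. of_bool (P xs \<rho>))"
  shows "feasible (\<lambda>xs \<rho>. of_bool (\<not> P xs \<rho>))"
proof -
  have "of_bool (\<not> p) = 1 - (of_bool p :: nat)" for p by simp
  then show ?thesis
    using feasible_minus[OF feasible_const[of 1] assms] by (simp only:)
qed

lemma feasible_and:
  assumes "feasible (\<lambda>xs \<rho>. of_bool (P xs \<rho>))" "feasible (\<lambda>xs \<rho>. of_bool (Q xs \<rho>))"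
  shows "feasible (\<lambda>xs \<rho>. of_bool (P xs \<rho> \<and> Q xs \<rho>))"
  using feasible_mult[OF assms] by (simp only: of_bool_conj)

lemma feasible_or:
  assumes "feasible (\<lambda>xs \<rho>. of_bool (P xs \<rho>))" "feasible (\<lambda>xs \<rho>. of_bool (Q xs \<rho>))"
  shows "feasible (\<lambda>xs \<rho>. of_bool (P xs \<rho> \<or> Q xs \<rho>))"
  using feasible_not[OF feasible_and[OF assms[THEN feasible_not]]] by (simp only: de_Morgan_conj not_not)

lemma feasible_imp:
  assumes "feasible (\<lambda>xs \<rho>. of_bool (P xs \<rho>))" "feasible (\<lambda>xs \<rho>. of_bool (Q xs \<rho>))"
  shows "feasible (\<lambda>xs \<rho>. of_bool (P xs \<rho> \<longrightarrow> Q xs \<rho>))"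
  using feasible_or[OF assms(1)[THEN feasible_not] assms(2)] by (simp only: imp_conv_disj)

lemma feasible_iff:
  assumes "feasible (\<lambda>xs \<rho>. of_bool (P xs \<rho>))" "feasible (\<lambda>xs \<rho>. of_bool (Q xs \<rho>))"
  shows "feasible (\<lambda>xs \<rho>. of_bool (P xs \<rho> \<longleftrightarrow> Q xs \<rho>))"
  using feasible_and[OF feasible_imp[OF assms] feasible_imp[OF assms(2,1)]] by (simp only: iff_conv_conj_imp)

text \<open>Two further truncated subtractions turn \<open>b - a\<close> into its sign.\<close>

lemma feasible_less:
  assumes "feasible f" "feasible g"
  shows "feasible (\<lambda>xs \<rho>. of_bool (f xs \<rho> < g xs \<rho>))"
proof -
  have "of_bool (a < b) = 1 - (1 - (b - a))" for a b :: nat by auto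
  then show ?thesis
    using feasible_minus[OF feasible_const[of 1] feasible_minus[OF feasible_const[of 1] feasible_minus[OF assms(2,1)]]]
    by (simp only:)
qed

lemma feasible_le:
  assumes "feasible f" "feasible g"
  shows "feasible (\<lambda>xs \<rho>. of_bool (f xs \<rho> \<le> g xs \<rho>))"
  using feasible_not[OF feasible_less[OF assms(2,1)]] by (simp only: not_less)

lemma feasible_eq:
  assumes "feasible f" "feasible g"
  shows "feasible (\<lambda>xs \<rho>. of_bool (f xs \<rho> = g xs \<rho>))"
  using feasible_and[OF feasible_le[OF assms] feasible_le[OF assms(2,1)]] by (simp only: eq_iff)

lemma feasible_ex:
  assumes f: "feasible f" and P: "feasible (\<lambda>xs \<rho>. of_bool (P xs (\<lambda>x. \<rho> (Suc x)) (\<rho> 0)))"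
  shows "feasible (\<lambda>xs \<rho>. of_bool (\<exists>i<f xs \<rho>. P xs \<rho> i))"
proof -
  have "0 < (\<Sum>i<b. of_bool (Q i) :: nat) \<longleftrightarrow> (\<exists>i<b. Q i)" for b :: nat and Q
    by (auto simp: sum_eq_0_iff zero_less_iff_neq_zero)
  then show ?thesis
    using feasible_less[OF feasible_const[of 0] feasible_sum[OF f, of "\<lambda>xs \<rho> i. of_bool (P xs \<rho> i)", OF P]]
    by (simp only:)
qed

lemma feasible_all:
  assumes f: "feasible f" and P: "feasible (\<lambda>xs \<rho>. of_bool (P xs (\<lambda>x. \<rho> (Suc x)) (\<rho> 0)))"
  shows "feasible (\<lambda>xs \<rho>. of_bool (\<forall>i<f xs \<rho>. P xs \<rho> i))"
  using feasible_not[OF feasible_ex[OF f, of "\<lambda>xs \<rho> i. \<not> P xs \<rho> i", OF feasible_not[OF P]]]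
  by (simp only: not_ex not_not de_Morgan_conj imp_conv_disj)

text \<open>The disjunct \<open>b \<le> i\<close> makes the search total, with default value
  \<open>b\<close> on failure.\<close>

definition least_below :: "nat \<Rightarrow> (nat \<Rightarrow> bool) \<Rightarrow> nat" where
  "least_below b P = (LEAST i. b \<le> i \<or> P i)"

lemma least_below_eqI: "P i \<Longrightarrow> i < b \<Longrightarrow> (\<And>j. j < i \<Longrightarrow> \<not> P j) \<Longrightarrow> least_below b P = i"
  unfolding least_below_def by (rule Least_equality) (simp, metis le_trans nat_le_linear nless_le)

lemma least_below:
  assumes "P i" "i < b"
  shows "least_below b P < b" "P (least_below b P)"
proof -
  have le: "least_below b P \<le> i" unfolding least_below_def by (rule Least_le) (use assms in blast)
  then show "least_below b P < b" using assms by simp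
  moreover have "b \<le> least_below b P \<or> P (least_below b P)"
    unfolding least_below_def by (rule LeastI[where k = b]) blast
  ultimately show "P (least_below b P)" by simp
qed

text \<open>The sum counts the indices strictly before the first hit, all \<open>b\<close> of them
  if there is none; this turns search into summation.\<close>

lemma least_below_conv_sum: "least_below b P = (\<Sum>i<b. of_bool (\<forall>j<Suc i. \<not> P j))"
proof -
  have 1: "b \<le> least_below b P \<or> P (least_below b P)"
    unfolding least_below_def by (rule LeastI[where k = b]) blast
  have 2: "j < b \<and> \<not> P j" if "j < least_below b P" for j
    using not_less_Least[OF that[unfolded least_below_def]] by auto
  have "{i. i < b \<and> (\<forall>j<Suc i. \<not> P j)} = {..<least_below b P}"
  proof (intro set_eqI iffI)
    fix i assume "i \<in> {i. i < b \<and> (\<forall>j<Suc i. \<not> P j)}"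
    then show "i \<in> {..<least_below b P}" using 1 by (cases "i < least_below b P")
      (auto simp: not_less less_Suc_eq_le)
  next
    fix i assume "i \<in> {..<least_below b P}"
    then have "\<And>j. j < Suc i \<Longrightarrow> j < least_below b P" by simp
    then show "i \<in> {i. i < b \<and> (\<forall>j<Suc i. \<not> P j)}" using 2 by blast
  qed
  moreover have "{..<b} \<inter> {i. \<forall>j<Suc i. \<not> P j} = {i. i < b \<and> (\<forall>j<Suc i. \<not> P j)}" by auto
  ultimately show ?thesis by (simp add: sum_of_bool_eq)
qed

lemma feasible_least_below:
  assumes f: "feasible f" and P: "feasible (\<lambda>xs \<rho>. of_bool (P xs (\<lambda>x. \<rho> (Suc x)) (\<rho> 0)))"
  shows "feasible (\<lambda>xs \<rho>. least_below (f xs \<rho>) (P xs \<rho>))"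
  unfolding least_below_conv_sum
  \<comment> \<open>Under the quantifier, variable 0 is \<open>j\<close> and variable 1 is the
    summation index, which \<open>P\<close> must skip; hence the double \<open>Suc\<close> in the
    renaming.\<close>
  by (intro feasible_sum f feasible_all feasible_Suc feasible_not feasible_var)
    (use feasible_rename[OF P, of "case_nat 0 (\<lambda>x. Suc (Suc x))"] in simp)

lemmas feasible_intros = feasible_const feasible_var feasible_length feasible_plus feasible_minus
  feasible_mult feasible_Suc feasible_sum feasible_not feasible_and feasible_or feasible_imp feasible_iff
  feasible_less feasible_le feasible_eq feasible_ex feasible_all feasible_least_below

section \<open>The largest signature class\<close>

text \<open>
  Below, \<open>n\<close> is the number of vertices, \<open>d\<close> the window length, \<open>k\<close> the number of windows, and \<open>N t\<close> the
  reflexive adjacency relation of layer \<open>t + 1\<close> on vertex indices: layers and windows are counted from 0.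
\<close>

definition splits :: "nat \<Rightarrow> (nat \<Rightarrow> nat \<Rightarrow> nat \<Rightarrow> bool) \<Rightarrow> nat \<Rightarrow> nat \<Rightarrow> nat \<Rightarrow> bool" where
  "splits n N t v w \<longleftrightarrow> N t v w \<and>
     (\<forall>x<n. \<forall>y<n. N t v x \<and> N t v y \<and> (N t w x \<longleftrightarrow> N t w y) \<longrightarrow> N t x y)"

definition pivot :: "nat \<Rightarrow> (nat \<Rightarrow> nat \<Rightarrow> nat \<Rightarrow> bool) \<Rightarrow> nat \<Rightarrow> nat \<Rightarrow> nat" where
  "pivot n N t v = least_below n (splits n N t v)"

definition assoc :: "nat \<Rightarrow> nat \<Rightarrow> (nat \<Rightarrow> nat \<Rightarrow> nat \<Rightarrow> bool) \<Rightarrow> nat \<Rightarrow> nat \<Rightarrow> bool" where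
  "assoc d k N v u \<longleftrightarrow> (\<forall>i<k. \<exists>j<d. N (i + j) v u)"

definition contact :: "nat \<Rightarrow> (nat \<Rightarrow> nat \<Rightarrow> nat \<Rightarrow> bool) \<Rightarrow> nat \<Rightarrow> nat \<Rightarrow> nat \<Rightarrow> nat" where
  "contact d N i v u = least_below d (\<lambda>j. N (i + j) v u)"

definition side :: "nat \<Rightarrow> nat \<Rightarrow> (nat \<Rightarrow> nat \<Rightarrow> nat \<Rightarrow> bool) \<Rightarrow> nat \<Rightarrow> nat \<Rightarrow> nat \<Rightarrow> bool" where
  "side n d N i v u \<longleftrightarrow> N (i + contact d N i v u) (pivot n N (i + contact d N i v u) v) u"

text \<open>Equality of signatures, restricted to the closed association neighbourhood of
  \<open>v\<close>; a vertex \<open>u\<close> outside it gets an empty class.\<close>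

definition alike :: "nat \<Rightarrow> nat \<Rightarrow> nat \<Rightarrow> (nat \<Rightarrow> nat \<Rightarrow> nat \<Rightarrow> bool) \<Rightarrow> nat \<Rightarrow> nat \<Rightarrow> nat \<Rightarrow> bool" where
  "alike n d k N v u x \<longleftrightarrow> assoc d k N v u \<and> assoc d k N v x \<and>
     (\<forall>i<k. contact d N i v u = contact d N i v x \<and> (side n d N i v u \<longleftrightarrow> side n d N i v x))"

definition class_size :: "nat \<Rightarrow> nat \<Rightarrow> nat \<Rightarrow> (nat \<Rightarrow> nat \<Rightarrow> nat \<Rightarrow> bool) \<Rightarrow> nat \<Rightarrow> nat \<Rightarrow> nat" where
  "class_size n d k N v u = (\<Sum>x<n. of_bool (alike n d k N v u x))"

definition largest :: "nat \<Rightarrow> nat \<Rightarrow> nat \<Rightarrow> (nat \<Rightarrow> nat \<Rightarrow> nat \<Rightarrow> bool) \<Rightarrow> nat \<Rightarrow> nat \<Rightarrow> bool" where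
  "largest n d k N v u \<longleftrightarrow> (\<forall>v'<n. \<forall>u'<n. class_size n d k N v' u' \<le> class_size n d k N v u)"

text \<open>A maximising pair is located by two searches over single vertices: first a centre that
  occurs in such a pair, then a partner for it.\<close>

definition best_center :: "nat \<Rightarrow> nat \<Rightarrow> nat \<Rightarrow> (nat \<Rightarrow> nat \<Rightarrow> nat \<Rightarrow> bool) \<Rightarrow> nat" where
  "best_center n d k N = least_below n (\<lambda>v. \<exists>u<n. largest n d k N v u)"

definition best_member :: "nat \<Rightarrow> nat \<Rightarrow> nat \<Rightarrow> (nat \<Rightarrow> nat \<Rightarrow> nat \<Rightarrow> bool) \<Rightarrow> nat" where
  "best_member n d k N = least_below n (largest n d k N (best_center n d k N))"

definition chosen :: "nat \<Rightarrow> nat \<Rightarrow> nat \<Rightarrow> (nat \<Rightarrow> nat \<Rightarrow> nat \<Rightarrow> bool) \<Rightarrow> nat \<Rightarrow> bool" where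
  "chosen n d k N = alike n d k N (best_center n d k N) (best_member n d k N)"

section \<open>Signature classes: clique property and size\<close>

lemma contact:
  assumes "assoc d k N v u" "i < k"
  shows "contact d N i v u < d" "N (i + contact d N i v u) v u"
proof -
  obtain j where j: "j < d" "N (i + j) v u" using assms by (auto simp: assoc_def)
  show "contact d N i v u < d" "N (i + contact d N i v u) v u"
    unfolding contact_def using least_below[of "\<lambda>j. N (i + j) v u", OF j(2,1)] .
qed

text \<open>In each window, \<open>x\<close> and \<open>y\<close> first meet \<open>v\<close> in the
  same layer and lie there on the same side of the pivot, so they are adjacent in that very
  layer.\<close>

lemma alike_imp_assoc:
  assumes ex: "\<And>t v. t + 1 < k + d \<Longrightarrow> v < n \<Longrightarrow> \<exists>w<n. splits n N t v w"
    and "v < n" "x < n" "y < n" and a: "alike n d k N v u x" "alike n d k N v u y"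
  shows "assoc d k N x y"
  unfolding assoc_def
proof (intro allI impI)
  fix i assume i: "i < k"
  let ?j = "contact d N i v u"
  have jx: "contact d N i v x = ?j" and jy: "contact d N i v y = ?j"
    and s: "side n d N i v x \<longleftrightarrow> side n d N i v y"
    and ax: "assoc d k N v x" and ay: "assoc d k N v y" using a i by (auto simp: alike_def)
  have j: "?j < d" "N (i + ?j) v x" "N (i + ?j) v y"
    using contact[OF ax i] contact[OF ay i] jx jy by auto
  \<comment> \<open>The layer \<open>i + ?j\<close> exists: \<open>k\<close> windows of length
    \<open>d\<close> cover the layers 0 to \<open>k + d - 2\<close>.\<close>
  obtain w where "w < n" "splits n N (i + ?j) v w" using ex[of "i + ?j" v] i j \<open>v < n\<close> by auto
  then have "splits n N (i + ?j) v (pivot n N (i + ?j) v)"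
    unfolding pivot_def by (intro least_below(2))
  then have "N (i + ?j) x y"
    using s j assms(3,4) by (simp add: splits_def side_def jx jy)
  then show "\<exists>j<d. N (i + j) x y" using j by blast
qed

text \<open>Pigeonhole on signatures: some fibre of the signature map on \<open>C\<close> carries at
  least the average, and it lies in the class of any of its members.\<close>

lemma card_le_class_size:
  assumes C: "C \<subseteq> {..<n}" "\<And>x. x \<in> C \<Longrightarrow> assoc d k N v x" and "C \<noteq> {}" "0 < d"
  shows "\<exists>u<n. card C \<le> class_size n d k N v u * (2 * d) ^ k"
proof -
  \<comment> \<open>Restricting to \<open>{..<k}\<close> puts signatures into a finite extensional
    function space with \<open>(2 * d) ^ k\<close> elements.\<close>
  define \<sigma> where "\<sigma> u = (\<lambda>i\<in>{..<k}. (contact d N i v u, side n d N i v u))" for u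
  let ?S = "{..<k} \<rightarrow>\<^sub>E {..<d} \<times> (UNIV :: bool set)"
  have fin: "finite C" using C(1) finite_subset by blast
  have card: "card ?S = (2 * d) ^ k" by (simp add: card_funcsetE mult.commute)
  have "\<sigma> \<in> C \<rightarrow> ?S"
    unfolding \<sigma>_def by (intro Pi_I restrict_PiE_iff[THEN iffD2]) (auto intro: contact(1)[OF C(2)])
  moreover have "finite ?S" by (intro finite_PiE) auto
  moreover have "?S \<noteq> {}" using \<open>0 < d\<close> by (auto simp: PiE_eq_empty_iff)
  ultimately obtain z where z: "card (\<sigma> -` {z} \<inter> C) * card ?S \<ge> card C"
    using pigeonhole_card[of \<sigma> C ?S] fin by blast
  have "0 < card C" using fin \<open>C \<noteq> {}\<close> by (simp add: card_gt_0_iff)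
  then have "\<sigma> -` {z} \<inter> C \<noteq> {}" using z by (intro notI) simp
  then obtain u where u: "u \<in> C" "\<sigma> u = z" by blast
  have "alike n d k N v u x" if "x \<in> C" "\<sigma> x = z" for x
  proof -
    have "\<sigma> u i = \<sigma> x i" for i using u that by simp
    then have "contact d N i v u = contact d N i v x \<and> side n d N i v u = side n d N i v x" if "i < k" for i
      using that by (simp add: \<sigma>_def restrict_def split: if_splits) (metis that prod.inject)
    then show ?thesis using C(2) u that by (simp add: alike_def)
  qed
  then have "\<sigma> -` {z} \<inter> C \<subseteq> {..<n} \<inter> {x. alike n d k N v u x}" using C(1) by blast
  then have "card (\<sigma> -` {z} \<inter> C) \<le> class_size n d k N v u"
    unfolding class_size_def by (simp add: sum_of_bool_eq card_mono)
  then have "card (\<sigma> -` {z} \<inter> C) * (2 * d) ^ k \<le> class_size n d k N v u * (2 * d) ^ k" by simp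
  then show ?thesis using z u(1) C(1) unfolding card by (meson le_trans lessThan_iff subsetD)
qed

lemma best:
  assumes "0 < n"
  shows "best_center n d k N < n" "best_member n d k N < n"
    "largest n d k N (best_center n d k N) (best_member n d k N)"
proof -
  let ?f = "\<lambda>(v, u). class_size n d k N v u" and ?A = "{..<n} \<times> {..<n}"
  have "finite (?f ` ?A)" "?f ` ?A \<noteq> {}" using assms by auto
  then obtain p where p: "p \<in> ?A" "Max (?f ` ?A) = ?f p" using Max_in by blast
  then have "?f q \<le> ?f p" if "q \<in> ?A" for q
    using Max_ge[of "?f ` ?A" "?f q"] that by auto
  then have "largest n d k N (fst p) (snd p)" by (force simp: largest_def split: prod.splits)
  then have *: "\<exists>u<n. largest n d k N (fst p) u" "fst p < n" using p(1) by auto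
  then show "best_center n d k N < n" unfolding best_center_def
    using least_below(1)[of "\<lambda>v. \<exists>u<n. largest n d k N v u"] by blast
  have "\<exists>u<n. largest n d k N (best_center n d k N) u" unfolding best_center_def
    using least_below(2)[of "\<lambda>v. \<exists>u<n. largest n d k N v u", OF *] .
  then show "best_member n d k N < n" "largest n d k N (best_center n d k N) (best_member n d k N)"
    unfolding best_member_def using least_below by blast+
qed

lemma chosen_clique:
  assumes "\<And>t v. t + 1 < k + d \<Longrightarrow> v < n \<Longrightarrow> \<exists>w<n. splits n N t v w"
    and "x < n" "y < n" "chosen n d k N x" "chosen n d k N y"
  shows "assoc d k N x y"
  using assms alike_imp_assoc best(1) unfolding chosen_def by (metis gr_zeroI not_less_zero)

text \<open>A clique lies in the closed neighbourhood of each of its members \<open>v\<close>, so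
  the pigeonhole bound applies around \<open>v\<close>, and the chosen class is at least as large as
  any class there.\<close>

lemma card_chosen:
  assumes C: "C \<subseteq> {..<n}" "\<And>x y. x \<in> C \<Longrightarrow> y \<in> C \<Longrightarrow> assoc d k N x y" and "0 < d"
  shows "card C \<le> card {x. x < n \<and> chosen n d k N x} * (2 * d) ^ k"
proof (cases "C = {}")
  case False
  then obtain v where v: "v \<in> C" by blast
  then obtain u where u: "u < n" "card C \<le> class_size n d k N v u * (2 * d) ^ k"
    using card_le_class_size[of C n d k N v] assms False by blast
  have "v < n" using C(1) v by auto
  then have "class_size n d k N v u \<le> class_size n d k N (best_center n d k N) (best_member n d k N)"
    using best(3)[of n d k N] u(1) by (simp add: largest_def)
  also have "\<dots> = card {x. x < n \<and> chosen n d k N x}"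
    unfolding class_size_def chosen_def by (simp add: sum_of_bool_eq Int_def)
  finally show ?thesis using u(2) by (meson le_trans mult_le_mono1)
qed simp

section \<open>Pivots from interval geometry\<close>

lemma unit_interval_graph_splits:
  assumes G: "unit_interval_graph V E" and V: "finite V" "v \<in> V"
  defines "N \<equiv> \<lambda>u w. u = w \<or> {u, w} \<in> E"
  shows "\<exists>w\<in>V. N v w \<and> (\<forall>x\<in>V. \<forall>y\<in>V. N v x \<and> N v y \<and> (N w x \<longleftrightarrow> N w y) \<longrightarrow> N x y)"
proof -
  obtain l :: real and I :: "'a \<Rightarrow> real set" where l: "l > 0" and "\<forall>v\<in>V. \<exists>a. I v = {a..a + l}"
    and E: "E = {{u, v} | u v. u \<in> V \<and> v \<in> V \<and> u \<noteq> v \<and> I u \<inter> I v \<noteq> {}}"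
    using G unfolding unit_interval_graph_def by blast
  then obtain a where a: "\<And>v. v \<in> V \<Longrightarrow> I v = {a v..a v + l}" by metis
  \<comment> \<open>Adjacency becomes closeness of left ends, so vertices whose left ends lie in a
    common segment of length \<open>l\<close> form a clique. The case \<open>u = w\<close> is
    absorbed since \<open>l > 0\<close>.\<close>
  have N: "N u w \<longleftrightarrow> \<bar>a u - a w\<bar> \<le> l" if "u \<in> V" "w \<in> V" for u w
  proof -
    have I: "I u \<inter> I w \<noteq> {} \<longleftrightarrow> \<bar>a u - a w\<bar> \<le> l"
      using a[OF that(1)] a[OF that(2)] l by (auto simp: abs_le_iff)
    have "N u w \<longleftrightarrow> u = w \<or> I u \<inter> I w \<noteq> {}"
      using that unfolding N_def E by (auto simp: doubleton_eq_iff Int_commute)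
    with I l show ?thesis by auto
  qed
  \<comment> \<open>Choose the leftmost neighbour \<open>w\<close> of \<open>v\<close>: the neighbours of \<open>v\<close> adjacent to \<open>w\<close> start in
    \<open>[a w, a w + l]\<close>, the others in \<open>[a v, a v + l]\<close>, as \<open>a v \<le> a w + l\<close>.\<close>
  let ?W = "{w \<in> V. N v w}"
  have "finite ?W" "v \<in> ?W" using V by (auto simp: N_def)
  then obtain w where w: "w \<in> ?W" "\<And>x. x \<in> ?W \<Longrightarrow> a w \<le> a x"
    using arg_min_if_finite(1)[of ?W a] arg_min_least[of ?W _ a] by blast
  then have wV: "w \<in> V" "N v w" by auto
  moreover have "N x y" if "x \<in> V" "y \<in> V" "N v x" "N v y" "N w x \<longleftrightarrow> N w y" for x y
  proof -
    have "a w \<le> a x" "a w \<le> a y" "a w \<le> a v" using w(2) that \<open>v \<in> ?W\<close> by auto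
    then show ?thesis using that wV V by (simp add: N) argo
  qed
  ultimately show ?thesis by blast
qed

section \<open>Decoding the instance\<close>

lemma length_concat_map_const:
  "(\<And>t. t \<in> set ts \<Longrightarrow> length (g t) = m) \<Longrightarrow> length (concat (map g ts)) = length ts * m"
  by (induction ts) auto

lemma nth_concat_map_const:
  assumes "\<And>t. t \<in> set ts \<Longrightarrow> length (g t) = m" "i < length ts" "j < m"
  shows "concat (map g ts) ! (i * m + j) = g (ts ! i) ! j"
  using assms
proof (induction ts arbitrary: i)
  case (Cons t ts)
  then show ?case by (cases i) (auto simp: nth_append add.assoc)
qed simp

text \<open>Row-major indexing, by two uses of \<open>nth_concat_map_const\<close>: blocks of length
  \<open>n * n\<close> for layers and \<open>n\<close> for rows. Layers are stored from 1 on, hence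
  \<open>Suc t\<close>.\<close>

lemma nth_matrices:
  fixes f :: "nat \<Rightarrow> 'a \<Rightarrow> 'a \<Rightarrow> bool"
  assumes "t < T" "u < length vs" "v < length vs"
  defines "n \<equiv> length vs"
  shows "(t * n + u) * n + v < length [f s x y. s \<leftarrow> [1..<T + 1], x \<leftarrow> vs, y \<leftarrow> vs]"
    "[f s x y. s \<leftarrow> [1..<T + 1], x \<leftarrow> vs, y \<leftarrow> vs] ! ((t * n + u) * n + v) = f (Suc t) (vs ! u) (vs ! v)"
proof -
  have un: "u * n + v < n * n"
  proof -
    have "u * n + v < (u + 1) * n" using assms by simp
    also have "\<dots> \<le> n * n" using assms by (intro mult_le_mono1) simp
    finally show ?thesis .
  qed
  have tn: "t * (n * n) + (u * n + v) < T * (n * n)"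
  proof -
    have "t * (n * n) + (u * n + v) < (t + 1) * (n * n)" using un by simp
    also have "\<dots> \<le> T * (n * n)" using assms by (intro mult_le_mono1) simp
    finally show ?thesis .
  qed
  have eq: "(t * n + u) * n + v = t * (n * n) + (u * n + v)" by (simp add: algebra_simps)
  have len: "length (concat (map (\<lambda>x. map (f s x) vs) vs)) = n * n" for s
    by (subst length_concat_map_const[where m = n]) (simp_all add: n_def)
  show "(t * n + u) * n + v < length [f s x y. s \<leftarrow> [1..<T + 1], x \<leftarrow> vs, y \<leftarrow> vs]"
    unfolding eq using tn by (subst length_concat_map_const[where m = "n * n"])
      (use assms(1) in \<open>simp_all add: len\<close>)
  show "[f s x y. s \<leftarrow> [1..<T + 1], x \<leftarrow> vs, y \<leftarrow> vs] ! ((t * n + u) * n + v) = f (Suc t) (vs ! u) (vs ! v)"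
    unfolding eq using assms(1-3) un nth_concat_map_const[of vs "\<lambda>x. map (f (Suc t) x) vs" n u v]
    by (subst nth_concat_map_const[where m = "n * n"]) (simp_all add: len n_def del: upt_Suc)
qed

definition input_bit :: "bool list \<Rightarrow> nat \<Rightarrow> bool" where
  "input_bit xs i \<longleftrightarrow> i < length xs \<and> xs ! i"

text \<open>Searching below \<open>length xs\<close> suffices, since a unary block ends with a zero
  inside the input.\<close>

definition unary_at :: "bool list \<Rightarrow> nat \<Rightarrow> nat" where
  "unary_at xs p = least_below (length xs) (\<lambda>i. \<not> input_bit xs (p + i))"

definition num_verts :: "bool list \<Rightarrow> nat" where
  "num_verts xs = unary_at xs 0"

text \<open>The terminating zeros of the preceding unary blocks account for the offsets 1, 2 and 3
  here and below.\<close>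

definition num_layers :: "bool list \<Rightarrow> nat" where
  "num_layers xs = unary_at xs (num_verts xs + 1)"

definition window_length :: "bool list \<Rightarrow> nat" where
  "window_length xs = unary_at xs (num_verts xs + num_layers xs + 2)"

definition num_windows :: "bool list \<Rightarrow> nat" where
  "num_windows xs = num_layers xs - window_length xs + 1"

text \<open>The disjunct \<open>u = v\<close> makes neighbourhoods closed, which the matrices alone
  do not.\<close>

definition near :: "bool list \<Rightarrow> nat \<Rightarrow> nat \<Rightarrow> nat \<Rightarrow> bool" where
  "near xs t u v \<longleftrightarrow> u = v \<or> input_bit xs
     (num_verts xs + num_layers xs + window_length xs + 3 + ((t * num_verts xs + u) * num_verts xs + v))"

section \<open>Feasibility of decoding and selection\<close>

lemma feasible_input_bit: "feasible f \<Longrightarrow> feasible (\<lambda>xs \<rho>. of_bool (input_bit xs (f xs \<rho>)))"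
  unfolding input_bit_def using feasible_comp1[OF feasible_bit_var[of 0]] by simp

lemma feasible_unary_at: "feasible f \<Longrightarrow> feasible (\<lambda>xs \<rho>. unary_at xs (f xs \<rho>))"
  by (rule feasible_comp1[of unary_at]) (unfold unary_at_def, intro feasible_intros feasible_input_bit)

lemma feasible_num_verts: "feasible (\<lambda>xs \<rho>. num_verts xs)"
  unfolding num_verts_def by (intro feasible_unary_at feasible_intros)

lemma feasible_num_layers: "feasible (\<lambda>xs \<rho>. num_layers xs)"
  unfolding num_layers_def by (intro feasible_unary_at feasible_intros feasible_num_verts)

lemma feasible_window_length: "feasible (\<lambda>xs \<rho>. window_length xs)"
  unfolding window_length_def
  by (intro feasible_unary_at feasible_intros feasible_num_verts feasible_num_layers)

lemma feasible_num_windows: "feasible (\<lambda>xs \<rho>. num_windows xs)"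
  unfolding num_windows_def by (intro feasible_intros feasible_num_layers feasible_window_length)

lemmas feasible_sizes = feasible_num_verts feasible_num_layers feasible_window_length feasible_num_windows

text \<open>Pattern for the lemmas below: the composition rule reduces to variables as arguments,
  and the unfolded definition is then covered by the closure rules. Arbitrary feasible arguments
  make the result itself usable as such a rule.\<close>

lemma feasible_near:
  "feasible f \<Longrightarrow> feasible g \<Longrightarrow> feasible h \<Longrightarrow>
   feasible (\<lambda>xs \<rho>. of_bool (near xs (f xs \<rho>) (g xs \<rho>) (h xs \<rho>)))"
  by (rule feasible_comp3[of "\<lambda>xs a b c. of_bool (near xs a b c)"])
    (unfold near_def, intro feasible_intros feasible_input_bit feasible_sizes)

lemma feasible_splits:
  "feasible f \<Longrightarrow> feasible g \<Longrightarrow> feasible h \<Longrightarrow>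
   feasible (\<lambda>xs \<rho>. of_bool (splits (num_verts xs) (near xs) (f xs \<rho>) (g xs \<rho>) (h xs \<rho>)))"
  by (rule feasible_comp3[of "\<lambda>xs a b c. of_bool (splits (num_verts xs) (near xs) a b c)"])
    (unfold splits_def, intro feasible_intros feasible_near feasible_sizes)

lemma feasible_pivot:
  "feasible f \<Longrightarrow> feasible g \<Longrightarrow> feasible (\<lambda>xs \<rho>. pivot (num_verts xs) (near xs) (f xs \<rho>) (g xs \<rho>))"
  by (rule feasible_comp2[of "\<lambda>xs. pivot (num_verts xs) (near xs)"])
    (unfold pivot_def, intro feasible_intros feasible_splits feasible_sizes)

lemma feasible_assoc:
  "feasible f \<Longrightarrow> feasible g \<Longrightarrow>
   feasible (\<lambda>xs \<rho>. of_bool (assoc (window_length xs) (num_windows xs) (near xs)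
     (f xs \<rho>) (g xs \<rho>)))"
  by (rule feasible_comp2[of "\<lambda>xs a b. of_bool (assoc (window_length xs) (num_windows xs) (near xs)
      a b)"])
    (unfold assoc_def, intro feasible_intros feasible_near feasible_sizes)

lemma feasible_contact:
  "feasible f \<Longrightarrow> feasible g \<Longrightarrow> feasible h \<Longrightarrow>
   feasible (\<lambda>xs \<rho>. contact (window_length xs) (near xs) (f xs \<rho>) (g xs \<rho>) (h xs \<rho>))"
  by (rule feasible_comp3[of "\<lambda>xs. contact (window_length xs) (near xs)"])
    (unfold contact_def, intro feasible_intros feasible_near feasible_sizes)

lemma feasible_side:
  "feasible f \<Longrightarrow> feasible g \<Longrightarrow> feasible h \<Longrightarrow>
   feasible (\<lambda>xs \<rho>. of_bool (side (num_verts xs) (window_length xs) (near xs) (f xs \<rho>) (g xs \<rho>) (h xs \<rho>)))"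
  by (rule feasible_comp3[of "\<lambda>xs a b c. of_bool (side (num_verts xs) (window_length xs) (near xs) a b c)"])
    (unfold side_def, intro feasible_intros feasible_near feasible_pivot feasible_contact feasible_sizes)

lemma feasible_alike:
  "feasible f \<Longrightarrow> feasible g \<Longrightarrow> feasible h \<Longrightarrow>
   feasible (\<lambda>xs \<rho>. of_bool (alike (num_verts xs) (window_length xs) (num_windows xs) (near xs)
     (f xs \<rho>) (g xs \<rho>) (h xs \<rho>)))"
  by (rule feasible_comp3[of "\<lambda>xs a b c. of_bool (alike (num_verts xs) (window_length xs) (num_windows xs) (near xs)
      a b c)"])
    (unfold alike_def, intro feasible_intros feasible_assoc feasible_side feasible_contact feasible_sizes)

lemma feasible_class_size:
  "feasible f \<Longrightarrow> feasible g \<Longrightarrow>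
   feasible (\<lambda>xs \<rho>. class_size (num_verts xs) (window_length xs) (num_windows xs) (near xs)
     (f xs \<rho>) (g xs \<rho>))"
  by (rule feasible_comp2[of "\<lambda>xs. class_size (num_verts xs) (window_length xs) (num_windows xs) (near xs)"])
    (unfold class_size_def, intro feasible_intros feasible_alike feasible_sizes)

lemma feasible_largest:
  "feasible f \<Longrightarrow> feasible g \<Longrightarrow>
   feasible (\<lambda>xs \<rho>. of_bool (largest (num_verts xs) (window_length xs) (num_windows xs) (near xs)
     (f xs \<rho>) (g xs \<rho>)))"
  by (rule feasible_comp2[of "\<lambda>xs a b. of_bool (largest (num_verts xs) (window_length xs) (num_windows xs) (near xs)
      a b)"])
    (unfold largest_def, intro feasible_intros feasible_class_size feasible_sizes)

text \<open>Centre and member are recomputed for every vertex tested, which keeps the time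
  polynomial.\<close>

lemma feasible_chosen:
  "feasible (\<lambda>xs \<rho>. of_bool (chosen (num_verts xs) (window_length xs) (num_windows xs) (near xs) (\<rho> 0)))"
  unfolding chosen_def best_member_def best_center_def
  by (intro feasible_intros feasible_alike feasible_largest feasible_sizes)

section \<open>Reading back an encoded instance\<close>

lemma unary_at_append:
  assumes "xs = pre @ unary m @ post" "p = length pre"
  shows "unary_at xs p = m"
  unfolding unary_at_def
  by (rule least_below_eqI) (use assms in \<open>auto simp: input_bit_def unary_def nth_append\<close>)

context
  fixes vs :: "nat list" and G :: "nat temporal_graph" and \<Delta> :: nat and xs
  defines "xs \<equiv> encode_instance vs G \<Delta>"
begin

lemma decode_sizes:
  "num_verts xs = length vs" "num_layers xs = lifetime G" "window_length xs = \<Delta>"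
proof -
  show n: "num_verts xs = length vs" unfolding num_verts_def
    by (rule unary_at_append[where pre = "[]"]) (simp_all add: xs_def encode_instance_def)
  show t: "num_layers xs = lifetime G" unfolding num_layers_def n
    by (rule unary_at_append[where pre = "unary (length vs)"])
      (simp_all add: xs_def encode_instance_def unary_def)
  show "window_length xs = \<Delta>" unfolding window_length_def n t
    by (rule unary_at_append[where pre = "unary (length vs) @ unary (lifetime G)"])
      (simp_all add: xs_def encode_instance_def unary_def)
qed

lemma near_encode:
  assumes "t < lifetime G" "u < length vs" "v < length vs"
  shows "near xs t u v \<longleftrightarrow> u = v \<or> {vs ! u, vs ! v} \<in> layer G (Suc t)"
proof -
  let ?M = "[{u, v} \<in> layer G t. t \<leftarrow> [1..<lifetime G + 1], u \<leftarrow> vs, v \<leftarrow> vs]"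
  let ?h = "unary (length vs) @ unary (lifetime G) @ unary \<Delta>"
  have xs: "xs = ?h @ ?M" by (simp add: xs_def encode_instance_def)
  have "length ?h = length vs + lifetime G + \<Delta> + 3" by (simp add: unary_def)
  then have "input_bit xs (length vs + lifetime G + \<Delta> + 3 + m) \<longleftrightarrow> m < length ?M \<and> ?M ! m" for m
    unfolding xs input_bit_def by (metis length_append nat_add_left_cancel_less nth_append_length_plus)
  then show ?thesis
    unfolding near_def decode_sizes
    using nth_matrices[OF assms, of "\<lambda>t u v. {u, v} \<in> layer G t"] by simp
qed

text \<open>Only distinct vertices are compared, because \<open>near\<close> is reflexive while
  edges have two ends. The rest is the shift from counting windows and layers from 0 to counting
  from 1.\<close>

lemma assoc_encode:
  assumes "1 \<le> \<Delta>" "\<Delta> \<le> lifetime G" "u < length vs" "v < length vs" "vs ! u \<noteq> vs ! v"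
  shows "assoc (window_length xs) (num_windows xs) (near xs) u v \<longleftrightarrow> {vs ! u, vs ! v} \<in> association_edges \<Delta> G"
proof -
  have "u \<noteq> v" using assms(5) by blast
  then have near: "near xs t u v \<longleftrightarrow> {vs ! u, vs ! v} \<in> layer G (Suc t)" if "t < lifetime G" for t
    using near_encode[OF that assms(3,4)] by simp
  let ?e = "{vs ! u, vs ! v}" and ?k = "lifetime G - \<Delta> + 1"
  \<comment> \<open>For \<open>i < ?k\<close> and \<open>j < \<Delta>\<close> the layer index
    \<open>i + j\<close> stays below \<open>lifetime G\<close>, so \<open>near\<close>
    applies.\<close>
  have "assoc (window_length xs) (num_windows xs) (near xs) u v \<longleftrightarrow>
      (\<forall>i<?k. \<exists>j<\<Delta>. ?e \<in> layer G (Suc (i + j)))"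
    unfolding assoc_def num_windows_def decode_sizes
    using near assms(2)
    by (metis (no_types, lifting) Suc_eq_plus1 add_mono_thms_linordered_field(4) le_add_diff_inverse2 less_Suc_eq_le add_Suc_right)
  also have "\<dots> \<longleftrightarrow> (\<forall>i\<in>{1..?k}. \<exists>j\<in>{i..i + \<Delta> - 1}. ?e \<in> layer G j)"
  proof (intro iffI allI impI ballI)
    fix i assume *: "\<forall>i<?k. \<exists>j<\<Delta>. ?e \<in> layer G (Suc (i + j))" and i: "i \<in> {1..?k}"
    then have "i - 1 < ?k" by auto
    with * obtain j where "j < \<Delta>" "?e \<in> layer G (Suc (i - 1 + j))" by blast
    then show "\<exists>j\<in>{i..i + \<Delta> - 1}. ?e \<in> layer G j" using i by (intro bexI[of _ "i + j"]) auto
  next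
    fix i assume *: "\<forall>i\<in>{1..?k}. \<exists>j\<in>{i..i + \<Delta> - 1}. ?e \<in> layer G j" and i: "i < ?k"
    then have "Suc i \<in> {1..?k}" by simp
    with * obtain j where "j \<in> {Suc i..Suc i + \<Delta> - 1}" "?e \<in> layer G j" by blast
    then show "\<exists>j<\<Delta>. ?e \<in> layer G (Suc (i + j))" using assms(1)
      by (intro exI[of _ "j - Suc i"]) auto
  qed
  finally show ?thesis by (simp add: association_edges_def)
qed

end

section \<open>The approximation guarantee\<close>

theorem theorem7:
  "temporal_clique_approximable_within temporal_unit_interval_graph
     (\<lambda>G \<Delta>. (2 * real \<Delta>) ^ (lifetime G - \<Delta> + 1))"
proof -
  \<comment> \<open>The selection depends on the bit string alone, so program and time bound are
    fixed before any instance is considered.\<close>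
  define sel where "sel xs = chosen (num_verts xs) (window_length xs) (num_windows xs) (near xs)" for xs
  obtain p q where pq: "\<And>xs. \<exists>t. runs p xs t (map (sel xs) [0..<num_verts xs]) \<and> t \<le> poly q (length xs)"
  proof -
    have "feasible (\<lambda>xs \<rho>. of_bool (sel xs (\<rho> 0)))" unfolding sel_def by (rule feasible_chosen)
    from runs_feasible[OF feasible_num_verts, of "\<lambda>xs i. of_bool (sel xs i)", OF this]
    show ?thesis using that by (simp only: of_bool_eq_0_iff not_not) blast
  qed
  show ?thesis
    unfolding temporal_clique_approximable_within_def
  proof (rule exI[of _ p], rule exI[of _ q], intro allI impI, elim conjE)
    fix G \<Delta> and vs :: "nat list"
    assume G: "temporal_unit_interval_graph G" and \<Delta>: "1 \<le> \<Delta>" "\<Delta> \<le> lifetime G"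
      and vs: "distinct vs" "set vs = verts G"
    define xs where "xs = encode_instance vs G \<Delta>"
    let ?n = "length vs" and ?k = "lifetime G - \<Delta> + 1" and ?N = "near xs"
    have sizes: "num_verts xs = ?n" "window_length xs = \<Delta>" "num_windows xs = ?k"
      by (simp_all add: xs_def num_windows_def decode_sizes)
    have sel: "sel xs = chosen ?n \<Delta> ?k ?N" by (simp add: sel_def sizes)
    have assoc: "assoc \<Delta> ?k ?N u v \<longleftrightarrow> {vs ! u, vs ! v} \<in> association_edges \<Delta> G"
      if "u < ?n" "v < ?n" "vs ! u \<noteq> vs ! v" for u v
      using assoc_encode[OF \<Delta> that] sizes by (simp add: xs_def)
    have refl: "assoc \<Delta> ?k ?N u u" for u
      using \<Delta> by (auto simp: assoc_def near_def intro!: exI[of _ 0])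
    have splits: "\<exists>w<?n. splits ?n ?N t v w" if "t + 1 < ?k + \<Delta>" "v < ?n" for t v
    proof -
      \<comment> \<open>Here \<open>?k + \<Delta> = lifetime G + 1\<close>, so the bound on
        \<open>t\<close> says exactly that layer \<open>Suc t\<close> exists.\<close>
      have v: "v < ?n" and t: "t < lifetime G" using that \<Delta> by simp_all
      from t have uig: "unit_interval_graph (verts G) (layer G (Suc t))"
        using G by (simp add: temporal_unit_interval_graph_def)
      define P where "P x y \<longleftrightarrow> x = y \<or> {x, y} \<in> layer G (Suc t)" for x y
      have "finite (verts G)" "vs ! v \<in> verts G" using v vs(2) by (metis finite_set, metis nth_mem)
      from unit_interval_graph_splits[OF uig this, folded P_def]
      obtain z where z: "z \<in> verts G" "P (vs ! v) z"
        "\<forall>x\<in>verts G. \<forall>y\<in>verts G. P (vs ! v) x \<and> P (vs ! v) y \<and> (P z x \<longleftrightarrow> P z y) \<longrightarrow> P x y"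
        by blast
      obtain w where w: "w < ?n" "vs ! w = z" using z(1) vs(2) by (metis in_set_conv_nth)
      \<comment> \<open>Distinctness of \<open>vs\<close> identifies equality of vertices with
        equality of indices, so the pivot \<open>z\<close> transfers to its index
        \<open>w\<close>.\<close>
      have N: "?N t a b \<longleftrightarrow> P (vs ! a) (vs ! b)" if "a < ?n" "b < ?n" for a b
        using near_encode[OF t that] that vs(1) by (simp add: xs_def P_def nth_eq_iff_index_eq)
      have mem: "vs ! a \<in> verts G" if "a < ?n" for a using that vs(2) nth_mem by blast
      have "splits ?n ?N t v w"
        unfolding splits_def
      proof (intro conjI allI impI)
        show "?N t v w" using N[OF v w(1)] z(2) w(2) by simp
        fix x y assume "x < ?n" "y < ?n" and "?N t v x \<and> ?N t v y \<and> ?N t w x = ?N t w y"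
        then show "?N t x y" using z(3)[rule_format, OF mem mem] N v w by metis
      qed
      then show ?thesis using w(1) by blast
    qed
    define X where "X = {x. x < ?n \<and> chosen ?n \<Delta> ?k ?N x}"
    define C where "C = (!) vs ` X"
    have cardC: "card C = card X"
      unfolding C_def using vs(1) by (intro card_image inj_onI) (auto simp: X_def nth_eq_iff_index_eq)
    have enc: "map (sel xs) [0..<num_verts xs] = encode_vertex_set vs C"
      using vs(1) by (intro nth_equalityI)
        (auto simp: encode_vertex_set_def sizes sel C_def X_def nth_eq_iff_index_eq)
    have "temporal_clique \<Delta> G C"
      unfolding temporal_clique_def clique_def
    proof (intro conjI ballI impI)
      show "C \<subseteq> verts G" unfolding vs(2)[symmetric] by (auto simp: C_def X_def)
      fix u v assume "u \<in> C" "v \<in> C" "u \<noteq> v"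
      then obtain x y where "x \<in> X" "y \<in> X" and uv: "u = vs ! x" "v = vs ! y"
        unfolding C_def by blast
      then have xy: "x < ?n" "y < ?n" "chosen ?n \<Delta> ?k ?N x" "chosen ?n \<Delta> ?k ?N y"
        by (simp_all add: X_def)
      then have "assoc \<Delta> ?k ?N x y"
        by (intro chosen_clique[where n = ?n and N = ?N] splits)
      then show "{u, v} \<in> association_edges \<Delta> G" using assoc[OF xy(1,2)] uv \<open>u \<noteq> v\<close> by simp
    qed
    moreover have "real (opt_temporal_clique \<Delta> G) / (2 * real \<Delta>) ^ ?k \<le> real (card C)"
    proof -
      \<comment> \<open>The optimum is attained: clique sizes form a finite set, nonempty because
        \<open>C\<close> itself is a clique.\<close>
      let ?S = "{card D | D. temporal_clique \<Delta> G D}"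
      have "?S \<subseteq> card ` Pow (verts G)" by (auto simp: temporal_clique_def clique_def)
      moreover have "finite (card ` Pow (verts G))" unfolding vs(2)[symmetric] by simp
      ultimately have "finite ?S" by (rule finite_subset)
      moreover have "?S \<noteq> {}" using \<open>temporal_clique \<Delta> G C\<close> by blast
      ultimately have "Max ?S \<in> ?S" by (rule Max_in)
      then obtain D where D: "temporal_clique \<Delta> G D" "opt_temporal_clique \<Delta> G = card D"
        unfolding opt_temporal_clique_def by blast
      \<comment> \<open>\<open>card_chosen\<close> speaks about indices, so the optimal clique
        \<open>D\<close> is pulled back along \<open>vs\<close>.\<close>
      let ?Y = "{x. x < ?n \<and> vs ! x \<in> D}"
      have "D \<subseteq> set vs" using D(1) vs(2) by (simp add: temporal_clique_def clique_def)
      then have DY: "D = (!) vs ` ?Y" by (fastforce simp: in_set_conv_nth subset_iff)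
      have "inj_on ((!) vs) ?Y" using vs(1) by (auto simp: inj_on_def nth_eq_iff_index_eq)
      then have cardD: "card D = card ?Y" using DY card_image by metis
      have "assoc \<Delta> ?k ?N x y" if "x \<in> ?Y" "y \<in> ?Y" for x y
      \<comment> \<open>The clique property covers distinct vertices only; the diagonal comes from
        reflexivity.\<close>
      proof (cases "x = y")
        case False
        then have "vs ! x \<noteq> vs ! y" using that vs(1) by (simp add: nth_eq_iff_index_eq)
        then show ?thesis using that D(1) assoc by (simp add: temporal_clique_def clique_def)
      next
        case True
        show ?thesis unfolding True by (rule refl)
      qed
      moreover have "?Y \<subseteq> {..<?n}" by auto
      ultimately have "card ?Y \<le> card X * (2 * \<Delta>) ^ ?k"
        unfolding X_def using \<Delta>(1) by (intro card_chosen) auto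
      then have "card D \<le> card X * (2 * \<Delta>) ^ ?k" using cardD by simp
      then have "real (card D) \<le> real (card X * (2 * \<Delta>) ^ ?k)" by (rule of_nat_mono)
      then show ?thesis
        using \<Delta>(1) unfolding D(2) cardC by (subst divide_le_eq) simp
    qed
    ultimately show "\<exists>C t. runs p (encode_instance vs G \<Delta>) t (encode_vertex_set vs C) \<and>
           t \<le> poly q (length (encode_instance vs G \<Delta>)) \<and> temporal_clique \<Delta> G C \<and>
           real (opt_temporal_clique \<Delta> G) / (2 * real \<Delta>) ^ ?k \<le> real (card C)"
      using pq[of xs, unfolded enc] unfolding xs_def by blast
  qed
qed

end
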